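(* Let $m,n\ge2$ and $k\geq 1$ be integers with $mn>k$. Suppose there exists a symmetric association scheme with 6 classes whose first and second eigenmatrices (for some ordering $A_0,\dots,A_6$ of the adjacency matrices and $E_0,\dots,E_6$ of the primitive idempotents) are $$P=\begin{pmatrix} 1 & 1 & 2 (n-1) & 2 (m-1) n & k & k & 2 (m n- k) \\ 1 & -1 & 0 & 0 & \sqrt{k} & -\sqrt{k} & 0 \\ 1 & 1 & 2 (n-1) & -2 n & 0 & 0 & 0 \\ 1 & -1 & 0 & 0 & -\sqrt{k} & \sqrt{k} & 0 \\ 1 & 1 & 2 (n-1) & 2 (m-1) n & -k & -k & 2 (k-m n) \\ 1 & 1 & -2 & 0 & \frac{\sqrt{k (m n-k)}}{\sqrt{m(n-1)}} & \frac{\sqrt{k (m n-k)}}{\sqrt{m(n-1)}} & -\frac{2 \sqrt{k (m n-k)}}{\sqrt{m(n-1)}} \\ 1 & 1 & -2 & 0 & -\frac{\sqrt{k (m n-k)}}{\sqrt{m(n-1)}} & -\frac{\sqrt{k (m n-k)}}{\sqrt{m(n-1)}} & \frac{2 \sqrt{k (m n-k)}}{\sqrt{m(n-1)}} \end{pmatrix},$$ $$Q=\begin{pmatrix} 1 & m n & 2 (m-1) & m n & 1 & m (n-1) & m (n-1) \\ 1 & -m n & 2 (m-1) & -m n & 1 & m (n-1) & m (n-1) \\ 1 & 0 & 2 (m-1) & 0 & 1 & -m & -m \\ 1 & 0 & -2 & 0 & 1 & 0 & 0 \\ 1 & \frac{m n}{\sqrt{k}} & 0 & -\frac{m n}{\sqrt{k}}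 & -1 & \frac{\sqrt{m(n-1)(m n-k)}}{\sqrt{k}} & -\frac{\sqrt{m(n-1)(m n-k)}}{\sqrt{k}} \\ 1 & -\frac{m n}{\sqrt{k}} & 0 & \frac{m n}{\sqrt{k}} & -1 & \frac{\sqrt{m(n-1)(m n-k)}}{\sqrt{k}} & -\frac{\sqrt{m(n-1)(m n-k)}}{\sqrt{k}} \\ 1 & 0 & 0 & 0 & -1 & -\frac{\sqrt{km(n-1)}}{\sqrt{m n-k}} & \frac{\sqrt{km(n-1)}}{\sqrt{m n-k}} \end{pmatrix}.$$ Then there exists a quasi-balanced weighing matrix $W$ such that $|W|$ is the incidence matrix of a symmetric group divisible design with parameters $(v,k,m,n,\lambda_1,\lambda_2)$, where $v=mn$, for some $\lambda_1,\lambda_2$, and such that $|W|\,\mathcal J_{m,n}=\mathcal J_{m,n}\,|W|=\frac{k}{m}J_v$.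
   Context: $I_r$, $J_r$ are the identity and all-ones matrices of order $r$, and $\mathcal J_{m,n}=I_m\otimes J_n$. A weighing matrix of order $v$ and weight $k$ is a $v\times v$ matrix $W$ with entries in $\{0,1,-1\}$ satisfying $WW^\top=kI_v$. $|W|$ is its entrywise absolute value. $W$ is quasi-balanced if $|W|\,|W|^\top=|W|^\top|W|$ and the off-diagonal entries of $|W|\,|W|^\top$ take at most two distinct values. For $m,n\ge2$ and $v=mn$, a $v\times v$ $(0,1)$-matrix $A$ is (the incidence matrix of) a symmetric group divisible design with parameters $(v,k,m,n,\lambda_1,\lambda_2)$ if $$AA^\top=A^\top A=kI_v+\lambda_1(\mathcal J_{m,n}-I_v)+\lambda_2(J_v-\mathcal J_{m,n}).$$ A symmetric association scheme with $d$ classes on a finite set $X$ is a set of nonzero $(0,1)$-matrices $A_0,\dots,A_d$ indexed by $X$ with $A_0=I$, $\sum_i A_i=J$, $A_i^\top=A_i$, and $A_iA_j=\sum_{h} p_{ij}^hA_h$ for non-negative integers $p_{ij}^h$. Its Bose–Mesner algebra (the complex span of the $A_i$) has a basis of primitive idempotents $E_0=\frac1{|X|}J,E_1,\dots,E_d$, and the first and second eigenmatrices $P,Q$ (rows and columns indexed from $0$ to $d$) are defined by $A_j=\sum_i P_{ij}E_i$ and $E_j=\frac1{|X|}\sum_i Q_{ij}A_i$. *)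

theory Defs
  imports Complex_Main "Jordan_Normal_Form.Matrix"
begin

definition all_ones_mat :: "nat \<Rightarrow> 'a :: one mat" where
  "all_ones_mat r = mat r r (\<lambda>_. 1)"

definition kronecker_mat :: "'a :: times mat \<Rightarrow> 'a mat \<Rightarrow> 'a mat" where
  "kronecker_mat A B = mat (dim_row A * dim_row B) (dim_col A * dim_col B)
     (\<lambda>(i, j). A $$ (i div dim_row B, j div dim_col B) * B $$ (i mod dim_row B, j mod dim_col B))"

definition group_mat :: "nat \<Rightarrow> nat \<Rightarrow> 'a :: semiring_1 mat" where
  "group_mat m n = kronecker_mat (1\<^sub>m m) (all_ones_mat n)"

definition abs_mat :: "'a :: abs mat \<Rightarrow> 'a mat" where
  "abs_mat W = map_mat abs W"

definition weighing_matrix :: "nat \<Rightarrow> nat \<Rightarrow> real mat \<Rightarrow> bool" where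
  "weighing_matrix v k W \<longleftrightarrow>
     W \<in> carrier_mat v v \<and> elements_mat W \<subseteq> {0, 1, -1} \<and>
     W * W\<^sup>T = of_nat k \<cdot>\<^sub>m 1\<^sub>m v"

definition quasi_balanced_weighing_matrix :: "nat \<Rightarrow> nat \<Rightarrow> real mat \<Rightarrow> bool" where
  "quasi_balanced_weighing_matrix v k W \<longleftrightarrow>
     weighing_matrix v k W \<and>
     abs_mat W * (abs_mat W)\<^sup>T = (abs_mat W)\<^sup>T * abs_mat W \<and>
     card {(abs_mat W * (abs_mat W)\<^sup>T) $$ (i, j) | i j. i < v \<and> j < v \<and> i \<noteq> j} \<le> 2"

definition symmetric_gdd ::
    "nat \<Rightarrow> nat \<Rightarrow> nat \<Rightarrow> nat \<Rightarrow> nat \<Rightarrow> nat \<Rightarrow> real mat \<Rightarrow> bool" where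
  "symmetric_gdd v k m n lam1 lam2 A \<longleftrightarrow>
     2 \<le> m \<and> 2 \<le> n \<and> v = m * n \<and>
     A \<in> carrier_mat v v \<and> elements_mat A \<subseteq> {0, 1} \<and>
     A * A\<^sup>T = A\<^sup>T * A \<and>
     A\<^sup>T * A = of_nat k \<cdot>\<^sub>m 1\<^sub>m v + of_nat lam1 \<cdot>\<^sub>m (group_mat m n - 1\<^sub>m v)
                + of_nat lam2 \<cdot>\<^sub>m (all_ones_mat v - group_mat m n)"

text \<open>The linear combination of \<open>B 0, \<dots>, B d\<close>, all of order \<open>N\<close>, with coefficients
  \<open>c 0, \<dots>, c d\<close>. It is formed entrywise since matrices of a fixed order are not a type
  on which \<^const>\<open>sum\<close> is available.\<close>

definition mat_lincomb :: "nat \<Rightarrow> nat \<Rightarrow> (nat \<Rightarrow> complex) \<Rightarrow> (nat \<Rightarrow> complex mat) \<Rightarrow> complex mat" where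
  "mat_lincomb N d c B = mat N N (\<lambda>(x, y). \<Sum>i\<le>d. c i * B i $$ (x, y))"

text \<open>The underlying set \<open>X\<close> of a scheme is enumerated as \<open>{0..<N}\<close> with \<open>N = card X\<close>.\<close>

definition symmetric_association_scheme :: "nat \<Rightarrow> nat \<Rightarrow> (nat \<Rightarrow> complex mat) \<Rightarrow> bool" where
  "symmetric_association_scheme N d A \<longleftrightarrow>
     (\<forall>i\<le>d. A i \<in> carrier_mat N N \<and> elements_mat (A i) \<subseteq> {0, 1} \<and> A i \<noteq> 0\<^sub>m N N) \<and>
     A 0 = 1\<^sub>m N \<and>
     mat_lincomb N d (\<lambda>_. 1) A = all_ones_mat N \<and>
     (\<forall>i\<le>d. (A i)\<^sup>T = A i) \<and>
     (\<exists>p :: nat \<Rightarrow> nat \<Rightarrow> nat \<Rightarrow> nat. \<forall>i\<le>d. \<forall>j\<le>d.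
        A i * A j = mat_lincomb N d (\<lambda>h. of_nat (p i j h)) A)"

definition mat_span :: "nat \<Rightarrow> nat \<Rightarrow> (nat \<Rightarrow> complex mat) \<Rightarrow> complex mat set" where
  "mat_span N d B = {mat_lincomb N d c B | c. True}"

abbreviation bose_mesner_algebra :: "nat \<Rightarrow> nat \<Rightarrow> (nat \<Rightarrow> complex mat) \<Rightarrow> complex mat set" where
  "bose_mesner_algebra \<equiv> mat_span"

definition primitive_idempotent :: "nat \<Rightarrow> complex mat set \<Rightarrow> complex mat \<Rightarrow> bool" where
  "primitive_idempotent N \<A> e \<longleftrightarrow>
     e \<in> \<A> \<and> e * e = e \<and> e \<noteq> 0\<^sub>m N N \<and>
     \<not> (\<exists>f\<in>\<A>. \<exists>g\<in>\<A>. f * f = f \<and> g * g = g \<and> f \<noteq> 0\<^sub>m N N \<and> g \<noteq> 0\<^sub>m N N \<and>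
          f * g = 0\<^sub>m N N \<and> g * f = 0\<^sub>m N N \<and> e = f + g)"

definition primitive_idempotent_basis ::
    "nat \<Rightarrow> nat \<Rightarrow> (nat \<Rightarrow> complex mat) \<Rightarrow> (nat \<Rightarrow> complex mat) \<Rightarrow> bool" where
  "primitive_idempotent_basis N d A E \<longleftrightarrow>
     (\<forall>i\<le>d. primitive_idempotent N (bose_mesner_algebra N d A) (E i)) \<and>
     E 0 = (1 / of_nat N) \<cdot>\<^sub>m all_ones_mat N \<and>
     mat_span N d E = bose_mesner_algebra N d A \<and>
     (\<forall>c. mat_lincomb N d c E = 0\<^sub>m N N \<longrightarrow> (\<forall>i\<le>d. c i = 0))"

definition first_eigenmatrix ::
    "nat \<Rightarrow> nat \<Rightarrow> (nat \<Rightarrow> complex mat) \<Rightarrow> (nat \<Rightarrow> complex mat) \<Rightarrow> complex mat \<Rightarrow> bool" where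
  "first_eigenmatrix N d A E P \<longleftrightarrow>
     P \<in> carrier_mat (d + 1) (d + 1) \<and>
     (\<forall>j\<le>d. A j = mat_lincomb N d (\<lambda>i. P $$ (i, j)) E)"

definition second_eigenmatrix ::
    "nat \<Rightarrow> nat \<Rightarrow> (nat \<Rightarrow> complex mat) \<Rightarrow> (nat \<Rightarrow> complex mat) \<Rightarrow> complex mat \<Rightarrow> bool" where
  "second_eigenmatrix N d A E Q \<longleftrightarrow>
     Q \<in> carrier_mat (d + 1) (d + 1) \<and>
     (\<forall>j\<le>d. E j = (1 / of_nat N) \<cdot>\<^sub>m mat_lincomb N d (\<lambda>i. Q $$ (i, j)) A)"

definition P_matrix :: "real \<Rightarrow> real \<Rightarrow> real \<Rightarrow> real mat" where
  "P_matrix m n k =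
    (let r = sqrt (k * (m * n - k)) / sqrt (m * (n - 1)) in
     mat_of_rows_list 7
      [[1,  1, 2 * (n - 1), 2 * (m - 1) * n,       k,        k, 2 * (m * n - k)],
       [1, -1,           0,               0,  sqrt k, - sqrt k,               0],
       [1,  1, 2 * (n - 1),         - 2 * n,       0,        0,               0],
       [1, -1,           0,               0, - sqrt k,  sqrt k,               0],
       [1,  1, 2 * (n - 1), 2 * (m - 1) * n,     - k,      - k, 2 * (k - m * n)],
       [1,  1,         - 2,               0,       r,        r,         - 2 * r],
       [1,  1,         - 2,               0,     - r,      - r,           2 * r]])"

definition Q_matrix :: "real \<Rightarrow> real \<Rightarrow> real \<Rightarrow> real mat" where
  "Q_matrix m n k =
    (let a = m * n / sqrt k;
         b = sqrt (m * (n - 1) * (m * n - k)) / sqrt k;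
         c = sqrt (k * m * (n - 1)) / sqrt (m * n - k) in
     mat_of_rows_list 7
      [[1,   m * n, 2 * (m - 1),   m * n,   1, m * (n - 1), m * (n - 1)],
       [1, - m * n, 2 * (m - 1), - m * n,   1, m * (n - 1), m * (n - 1)],
       [1,       0, 2 * (m - 1),       0,   1,         - m,         - m],
       [1,       0,         - 2,       0,   1,           0,           0],
       [1,       a,           0,     - a, - 1,           b,         - b],
       [1,     - a,           0,       a, - 1,           b,         - b],
       [1,       0,           0,       0, - 1,         - c,           c]])"

end

theory Submission
  imports Defs
begin

text \<open>
  The seven relations \<open>A 0, \<dots>, A 6\<close> are encoded by a function \<open>c x y\<close> with values in \<open>{0..6}\<close>.
  Orthogonality of the primitive idempotents turns products in the Bose-Mesner algebra into pointwise
  products of eigenvalue vectors, so that convolutions of functions of \<open>c\<close> are read off from \<open>P\<close> alone.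
  In this way \<open>c x y \<le> 1\<close>, \<open>c x y \<le> 2\<close> and \<open>c x y \<le> 3\<close> turn out to be nested equivalence relations with
  classes of sizes \<open>2\<close>, \<open>2n\<close> and \<open>2mn\<close>; the last one splits the points into two halves. Since
  \<open>A 4 - A 5\<close> is annihilated by \<open>A 0 + A 1\<close>, it changes sign inside each pair \<open>c x y \<le> 1\<close>, and its
  restriction to one representative of every pair, with rows from one half and columns from the other,
  is the weighing matrix. The identities for \<open>W\<close> and \<open>\<bar>W\<bar>\<close> are the halved convolutions of
  \<open>A 4 - A 5\<close>, \<open>A 4 + A 5\<close> and \<open>A 0 + A 1 + A 2\<close>.
\<close>

section \<open>Transversals of equivalence relations with classes of equal size\<close>

lemma ex_transversal:
  fixes R :: "'a \<Rightarrow> 'a \<Rightarrow> bool"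
  assumes "finite X" and "card X = s * t" and "s > 0"
    and refl: "\<And>x. x \<in> X \<Longrightarrow> R x x"
    and sym: "\<And>x y. x \<in> X \<Longrightarrow> y \<in> X \<Longrightarrow> R x y \<Longrightarrow> R y x"
    and trans: "\<And>x y z. x \<in> X \<Longrightarrow> y \<in> X \<Longrightarrow> z \<in> X \<Longrightarrow> R x y \<Longrightarrow> R y z \<Longrightarrow> R x z"
    and size: "\<And>x. x \<in> X \<Longrightarrow> card {y \<in> X. R x y} = s"
  shows "\<exists>g :: nat \<Rightarrow> 'a. (\<forall>i<t. g i \<in> X) \<and> (\<forall>i<t. \<forall>j<t. R (g i) (g j) \<longleftrightarrow> i = j) \<and>
           (\<forall>x\<in>X. \<exists>i<t. R (g i) x)"
proof -
  define r where "r = {(x, y). x \<in> X \<and> y \<in> X \<and> R x y}"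
  have eq: "equiv X r"
    unfolding equiv_def refl_on_def sym_def trans_def r_def using refl sym trans by blast
  have cls: "r `` {x} = {y \<in> X. R x y}" if "x \<in> X" for x
    using that by (auto simp: r_def)
  have fin: "finite (X // r)"
    using assms(1) eq by (simp add: finite_quotient equiv_type)
  \<comment> \<open>Counting \<open>X\<close> class by class shows that \<open>s\<close> times the
    number of classes is \<open>s * t\<close>; since \<open>s > 0\<close>, there are exactly
    \<open>t\<close> classes.\<close>
  have "s * card (X // r) = card (\<Union>(X // r))"
  proof (rule card_partition)
    show "card C = s" if "C \<in> X // r" for C
      using that by (rule quotientE) (simp add: cls size)
    show "C \<inter> D = {}" if "C \<in> X // r" "D \<in> X // r" "C \<noteq> D" for C D
      using quotient_disj[OF eq that(1,2)] that(3) by blast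
  qed (use fin assms(1) Union_quotient[OF eq] in auto)
  then have "card (X // r) = t"
    using Union_quotient[OF eq] assms(2,3) by simp
  then obtain h where h: "bij_betw h {..<t} (X // r)"
    using fin by (metis ex_bij_betw_nat_finite lessThan_atLeast0)
  define g where "g i = (SOME x. x \<in> h i)" for i
  have gh: "g i \<in> h i" "h i \<in> X // r" if "i < t" for i
  proof -
    show q: "h i \<in> X // r" using h that by (auto simp: bij_betw_def)
    then have "h i \<noteq> {}" using eq in_quotient_imp_non_empty by blast
    then show "g i \<in> h i" unfolding g_def by (simp add: some_in_eq)
  qed
  have gX: "g i \<in> X" if "i < t" for i
    using gh[OF that] eq in_quotient_imp_subset by blast
  \<comment> \<open>Each class is recovered from its representative, so related representatives come
    from the same class and injectivity of \<open>h\<close> gives equal indices.\<close>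
  have hg: "h i = r `` {g i}" if "i < t" for i
    using gh[OF that] eq by (metis Image_singleton_iff equiv_class_eq_iff quotientE)
  have "R (g i) (g j) \<longleftrightarrow> i = j" if "i < t" "j < t" for i j
  proof
    assume "R (g i) (g j)"
    then have "(g i, g j) \<in> r" using gX that by (simp add: r_def)
    then have "h i = h j" using hg that eq by (metis equiv_class_eq)
    then show "i = j" using h that by (auto simp: bij_betw_def inj_on_def)
  qed (use refl gX that in auto)
  moreover have "\<exists>i<t. R (g i) x" if "x \<in> X" for x
  proof -
    have "r `` {x} \<in> X // r" using that by (rule quotientI)
    then obtain i where i: "i < t" "h i = r `` {x}" using h by (metis bij_betw_def imageE lessThan_iff)
    then have "x \<in> r `` {g i}" using hg that eq by (metis equiv_class_self)
    then show ?thesis using i by (auto simp: r_def)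
  qed
  ultimately show ?thesis using gX by (intro exI[of _ g]) auto
qed

section \<open>Block indices and matrices given by functions\<close>

lemma mult_add_less:
  fixes a b m n :: nat
  assumes "a < m" "b < n"
  shows "a * n + b < m * n"
proof -
  have "a * n + b < Suc a * n" using assms(2) by simp
  also have "\<dots> \<le> m * n" using assms(1) by (intro mult_le_mono1) simp
  finally show ?thesis .
qed

lemma group_mat_carrier [simp]: "group_mat m n \<in> carrier_mat (m * n) (m * n)"
  by (simp add: group_mat_def kronecker_mat_def all_ones_mat_def)

lemma group_mat_index:
  assumes "i < m * n" "j < m * n"
  shows "group_mat m n $$ (i, j) = of_bool (i div n = j div n)"
proof -
  have "n > 0" using assms by (cases n) auto
  then show ?thesis using assms
    by (auto simp: group_mat_def kronecker_mat_def all_ones_mat_def less_mult_imp_div_less)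
qed

lemma sum_atMost_6: "(\<Sum>i\<le>(6::nat). f i) = f 0 + f 1 + f 2 + f 3 + f 4 + f 5 + (f 6 :: 'a :: comm_monoid_add)"
  by (simp add: numeral_eq_Suc ac_simps)

text \<open>The coefficient vector \<open>f\<close> stands for the matrix combination of the
  \<open>A j\<close> with coefficients \<open>f j\<close>; the value at \<open>i\<close> is its
  eigenvalue belonging to \<open>E i\<close>. It is real because \<open>P\<close> has real
  entries.\<close>

definition eigenvalue :: "nat \<Rightarrow> nat \<Rightarrow> nat \<Rightarrow> (nat \<Rightarrow> real) \<Rightarrow> nat \<Rightarrow> real" where
  "eigenvalue m n k f i = (\<Sum>j\<le>6. f j * P_matrix (real m) (real n) (real k) $$ (i, j))"

lemma mat_mult_mat:
  "mat a b f * mat b d g = mat a d (\<lambda>(i, j). \<Sum>l<b. f (i, l) * g (l, j))"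
  by (rule eq_matI) (simp_all add: scalar_prod_def lessThan_atLeast0)

lemma transpose_mat_mat: "(mat a b f)\<^sup>T = mat b a (\<lambda>(i, j). f (j, i))"
  by (rule eq_matI) simp_all

lemma group_mat_eq: "group_mat m n = mat (m * n) (m * n) (\<lambda>(i, j). of_bool (i div n = j div n))"
  by (rule eq_matI) (auto simp: group_mat_index carrier_matD[OF group_mat_carrier])

text \<open>The scheme reduced to its combinatorial content: \<open>c x y\<close> is the index of
  the relation that contains the pair. The assumption \<open>convolution\<close> carries all
  spectral information: if the eigenvalues of \<open>f\<close> and \<open>g\<close> multiply to
  those of \<open>h\<close>, then the matrices multiply accordingly, and this is stated
  entrywise.\<close>

locale weighing_scheme =
  fixes m n k N :: nat and c :: "nat \<Rightarrow> nat \<Rightarrow> nat"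
  assumes m: "2 \<le> m" and n: "2 \<le> n" and kmn: "k < m * n"
    and N_pos: "N > 0"
    and c_le: "x < N \<Longrightarrow> y < N \<Longrightarrow> c x y \<le> 6"
    and c_0: "x < N \<Longrightarrow> y < N \<Longrightarrow> c x y = 0 \<longleftrightarrow> x = y"
    and c_sym: "x < N \<Longrightarrow> y < N \<Longrightarrow> c x y = c y x"
    and convolution: "x < N \<Longrightarrow> y < N \<Longrightarrow>
      (\<And>i. i \<le> 6 \<Longrightarrow> eigenvalue m n k f i * eigenvalue m n k g i = eigenvalue m n k h i) \<Longrightarrow>
      (\<Sum>z<N. f (c x z) * g (c z y)) = h (c x y)"
begin

section \<open>Explicit products in the algebra of the scheme\<close>

definition "r = sqrt (real k * (real m * real n - real k)) / sqrt (real m * (real n - 1))"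

lemma r_square: "r * r = real k * (real m * real n - real k) / (real m * (real n - 1))"
proof -
  have "real k \<le> real m * real n" using kmn by (metis less_imp_le of_nat_le_iff of_nat_mult)
  then have "real k * (real m * real n - real k) \<ge> 0" "real m * (real n - 1) \<ge> 0" using n by simp_all
  then show ?thesis by (simp add: r_def)
qed

text \<open>One formula per row of \<open>P\<close>, with \<open>f\<close> arbitrary, so that every
  product below reduces to seven algebraic identities. The index \<open>Suc 0\<close> is the
  simplified form of 1.\<close>

lemma eigenvalue_eqs:
  fixes f :: "nat \<Rightarrow> real"
  shows
  "eigenvalue m n k f 0 = f 0 + f 1 + 2 * (real n - 1) * f 2 + 2 * (real m - 1) * real n * f 3
     + k * f 4 + k * f 5 + 2 * (real m * real n - k) * f 6"
  "eigenvalue m n k f (Suc 0) = f 0 - f 1 + sqrt k * f 4 - sqrt k * f 5"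
  "eigenvalue m n k f 2 = f 0 + f 1 + 2 * (real n - 1) * f 2 - 2 * real n * f 3"
  "eigenvalue m n k f 3 = f 0 - f 1 - sqrt k * f 4 + sqrt k * f 5"
  "eigenvalue m n k f 4 = f 0 + f 1 + 2 * (real n - 1) * f 2 + 2 * (real m - 1) * real n * f 3
     - k * f 4 - k * f 5 - 2 * (real m * real n - k) * f 6"
  "eigenvalue m n k f 5 = f 0 + f 1 - 2 * f 2 + r * f 4 + r * f 5 - 2 * r * f 6"
  "eigenvalue m n k f 6 = f 0 + f 1 - 2 * f 2 - r * f 4 - r * f 5 + 2 * r * f 6"
  unfolding eigenvalue_def sum_atMost_6 P_matrix_def Let_def r_def[symmetric]
  by (simp_all add: mat_of_rows_list_def) (simp_all add: algebra_simps)

lemma convolutionI: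
  assumes "x < N" "y < N"
    and "\<forall>i\<in>{0, 1, 2, 3, 4, 5, 6}. eigenvalue m n k f i * eigenvalue m n k g i = eigenvalue m n k h i"
  shows "(\<Sum>z<N. f (c x z) * g (c z y)) = h (c x y)"
proof (rule convolution[OF assms(1,2)])
  fix i :: nat assume "i \<le> 6"
  then have "i \<in> {0, 1, 2, 3, 4, 5, 6}" by auto
  then show "eigenvalue m n k f i * eigenvalue m n k g i = eigenvalue m n k h i" using assms(3) by blast
qed

text \<open>The constant vector 1 stands for the all-ones matrix. Its eigenvalue is
  \<open>4 * m * n\<close> in row 0 and 0 in all other rows, so its square is
  \<open>4 * m * n\<close> times itself, while each entry of the square is \<open>N\<close>.\<close>

lemma N_eq: "N = 4 * m * n"
proof -
  have "(\<Sum>z<N. (\<lambda>_. 1) (c 0 z) * (\<lambda>_. 1) (c z 0)) = (\<lambda>_. 4 * real m * real n) (c 0 0)"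
    by (rule convolutionI[OF N_pos N_pos]) (auto simp: eigenvalue_eqs algebra_simps)
  then have "real N = real (4 * m * n)" by simp
  then show ?thesis by (simp only: of_nat_eq_iff)
qed

text \<open>For \<open>a\<close> in {1, 2, 3} this is the sum of the entries 0 to \<open>a\<close>
  in row 0 of \<open>P\<close>, that is, the valency of the union of these relations.\<close>

definition class_size :: "nat \<Rightarrow> nat" where
  "class_size a = (if a = 1 then 2 else if a = 2 then 2 * n else 2 * m * n)"

text \<open>The eigenvalues of \<open>A 0 + ... + A a\<close> are 0 and \<open>class_size a\<close>
  only, so this matrix is a multiple of an idempotent. Transitivity of \<open>c x y \<le> a\<close>
  is extracted from this identity.\<close>

lemma equivalence_convolution:
  assumes "x < N" "y < N" and a: "a \<in> {1, 2, 3}"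
  shows "(\<Sum>z<N. of_bool (c x z \<le> a) * of_bool (c z y \<le> a)) = real (class_size a) * of_bool (c x y \<le> a)"
proof (rule convolutionI[where f = "\<lambda>j. of_bool (j \<le> a)" and g = "\<lambda>j. of_bool (j \<le> a)"
      and h = "\<lambda>j. real (class_size a) * of_bool (j \<le> a)", OF assms(1,2)])
  show "\<forall>i\<in>{0, 1, 2, 3, 4, 5, 6}. eigenvalue m n k (\<lambda>j. of_bool (j \<le> a)) i * eigenvalue m n k (\<lambda>j. of_bool (j \<le> a)) i =
         eigenvalue m n k (\<lambda>j. real (class_size a) * of_bool (j \<le> a)) i"
    using a by (auto simp: eigenvalue_eqs class_size_def algebra_simps)
qed

text \<open>The coefficient vector of \<open>A 4 - A 5\<close>; its absolute value is that of
  \<open>A 4 + A 5\<close>.\<close>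

definition sgn_rel :: "nat \<Rightarrow> real" where
  "sgn_rel j = (if j = 4 then 1 else if j = 5 then - 1 else 0)"

text \<open>The real values of \<open>\<lambda>\<^sub>1\<close> and \<open>\<lambda>\<^sub>2\<close>: the former is forced by row 5 of \<open>P\<close>, the latter by
  comparing rows 0 and 2.\<close>

definition mu1 :: real where "mu1 = real k - r * r"
definition mu2 :: real where "mu2 = real k ^ 2 / (real m * real n)"

text \<open>\<open>A 4 - A 5\<close> has nonzero eigenvalues only in rows 1 and 3, exactly where
  those of \<open>A 0 + A 1\<close> vanish.\<close>

lemma pair_sgn_convolution:
  assumes "x < N" "y < N"
  shows "(\<Sum>z<N. of_bool (c x z \<le> 1) * sgn_rel (c z y)) = 0"
  by (rule convolutionI[where f = "\<lambda>j. of_bool (j \<le> 1)" and h = "\<lambda>_. 0", OF assms])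
     (simp add: eigenvalue_eqs sgn_rel_def)

text \<open>The square of \<open>A 4 - A 5\<close> has eigenvalue \<open>4 * k\<close> in rows 1 and
  3 and 0 elsewhere; \<open>A 0 - A 1\<close> has eigenvalue 2 in these rows and 0
  elsewhere.\<close>

lemma sgn_sgn_convolution:
  assumes "x < N" "y < N"
  shows "(\<Sum>z<N. sgn_rel (c x z) * sgn_rel (c z y)) = 2 * real k * (of_bool (c x y = 0) - of_bool (c x y = 1))"
  by (rule convolutionI[where h = "\<lambda>j. 2 * real k * (of_bool (j = 0) - of_bool (j = 1))", OF assms])
     (simp add: eigenvalue_eqs sgn_rel_def)

lemma abs_abs_convolution:
  assumes "x < N" "y < N"
  shows "(\<Sum>z<N. \<bar>sgn_rel (c x z)\<bar> * \<bar>sgn_rel (c z y)\<bar>) =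
     2 * (if c x y \<le> 1 then real k else if c x y = 2 then mu1 else if c x y = 3 then mu2 else 0)"
proof -
  have ne: "real m * real n \<noteq> 0" "real m * (real n - 1) \<noteq> 0" using m n by auto
  have rr: "r * r * (real m * (real n - 1)) = real k * (real m * real n - real k)"
    using ne by (simp add: r_square)
  have mu2: "mu2 * (real m * real n) = real k * real k" using ne by (simp add: mu2_def power2_eq_square)
  \<comment> \<open>Row 2 of \<open>P\<close> annihilates \<open>A 4 + A 5\<close>, which forces
    this linear relation between \<open>mu1\<close> and \<open>mu2\<close>. With it, row 0 amounts
    to the defining equation of \<open>mu2\<close>.\<close>
  have row2: "real k + (real n - 1) * mu1 = real n * mu2"
  proof -
    have "real m * (real k + (real n - 1) * mu1) = real k * real m * real n - r * r * (real m * (real n - 1))"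
      by (simp add: mu1_def algebra_simps)
    also have "\<dots> = real m * (real n * mu2)" unfolding rr using mu2 by (simp add: algebra_simps)
    finally show ?thesis using m by simp
  qed
  show ?thesis
    apply (rule convolutionI[where f = "\<lambda>j. \<bar>sgn_rel j\<bar>" and g = "\<lambda>j. \<bar>sgn_rel j\<bar>"
      and h = "\<lambda>j. 2 * (if j \<le> 1 then real k else if j = 2 then mu1 else if j = 3 then mu2 else 0)", OF assms])
    using row2 mu2 apply (simp add: eigenvalue_eqs sgn_rel_def)
    apply (simp add: algebra_simps)
    apply (simp add: mu1_def algebra_simps)
    done
qed

text \<open>Only rows 0 and 4 survive in the product, with eigenvalues \<open>4 * k * n\<close> and
  its negative. There \<open>A 4 + A 5 + A 6\<close> has eigenvalues \<open>2 * m * n\<close> and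
  its negative, and it vanishes in the other rows.\<close>

lemma abs_group_convolution:
  assumes "x < N" "y < N"
  shows "(\<Sum>z<N. \<bar>sgn_rel (c x z)\<bar> * of_bool (c z y \<le> 2)) = 2 * (real k / real m) * of_bool (4 \<le> c x y \<and> c x y \<le> 6)"
  by (rule convolutionI[where f = "\<lambda>j. \<bar>sgn_rel j\<bar>" and g = "\<lambda>j. of_bool (j \<le> 2)"
      and h = "\<lambda>j. 2 * (real k / real m) * of_bool (4 \<le> j \<and> j \<le> 6)", OF assms])
     (use m in \<open>simp add: eigenvalue_eqs sgn_rel_def field_simps\<close>)

section \<open>The nested equivalence relations and their representatives\<close>

lemma rel_trans:
  assumes a: "a \<in> {1, 2, 3}" and N: "x < N" "y < N" "z < N" and "c x y \<le> a" "c y z \<le> a"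
  shows "c x z \<le> a"
proof (rule ccontr)
  assume "\<not> c x z \<le> a"
  then have "(\<Sum>w<N. of_bool (c x w \<le> a) * of_bool (c w z \<le> a)) = (0::real)"
    by (simp add: equivalence_convolution[OF N(1,3) a])
  \<comment> \<open>A vanishing sum of nonnegative terms has only zero terms, but the term at
    \<open>w = y\<close> is 1.\<close>
  then have "\<forall>w\<in>{..<N}. of_bool (c x w \<le> a) * of_bool (c w z \<le> a) = (0::real)"
    by (subst (asm) sum_nonneg_eq_0_iff) auto
  then show False using assms by auto
qed

lemma rel_sym: "x < N \<Longrightarrow> y < N \<Longrightarrow> c x y \<le> a \<Longrightarrow> c y x \<le> a"
  by (simp add: c_sym)

lemma rel_refl: "x < N \<Longrightarrow> c x x \<le> a"
  using c_0[of x x] by simp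

lemma card_class:
  assumes a: "a \<in> {1, 2, 3}" and x: "x < N"
  shows "card {y \<in> {..<N}. c x y \<le> a} = class_size a"
proof -
  have "real (card {y \<in> {..<N}. c x y \<le> a}) = (\<Sum>y<N. of_bool (c x y \<le> a))"
    by (subst sum_of_bool_eq) (auto intro: arg_cong[where f = card])
  also have "\<dots> = (\<Sum>y<N. of_bool (c x y \<le> a) * of_bool (c y x \<le> a))"
    by (intro sum.cong) (auto simp: c_sym[OF x])
  also have "\<dots> = class_size a"
    by (simp add: equivalence_convolution[OF x x a] rel_refl x)
  finally show ?thesis by simp
qed

lemma class_size_pos: "class_size a > 0"
  using m n by (simp add: class_size_def)

text \<open>One class of the coarser relation \<open>b\<close> serves as ground set for the finer
  relation \<open>a\<close>. This yields the groups inside a half and the pairs inside a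
  group.\<close>

lemma class_transversal:
  assumes ab: "a \<in> {1, 2, 3}" "b \<in> {1, 2, 3}" "a \<le> b"
    and t: "class_size b = class_size a * t" and x: "x < N"
  obtains g where "\<And>i. i < t \<Longrightarrow> g i < N" "\<And>i. i < t \<Longrightarrow> c x (g i) \<le> b"
    "\<And>i j. i < t \<Longrightarrow> j < t \<Longrightarrow> c (g i) (g j) \<le> a \<longleftrightarrow> i = j"
    "\<And>y. y < N \<Longrightarrow> c x y \<le> b \<Longrightarrow> \<exists>i<t. c (g i) y \<le> a"
proof -
  let ?X = "{y \<in> {..<N}. c x y \<le> b}"
  have "\<exists>g :: nat \<Rightarrow> nat. (\<forall>i<t. g i \<in> ?X) \<and> (\<forall>i<t. \<forall>j<t. c (g i) (g j) \<le> a \<longleftrightarrow> i = j) \<and>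
           (\<forall>y\<in>?X. \<exists>i<t. c (g i) y \<le> a)"
  proof (rule ex_transversal[where s = "class_size a" and R = "\<lambda>x y. c x y \<le> a"])
    show "card ?X = class_size a * t" using card_class[OF ab(2) x] t by simp
    show "card {z \<in> ?X. c y z \<le> a} = class_size a" if "y \<in> ?X" for y
    proof -
      have "{z \<in> ?X. c y z \<le> a} = {z \<in> {..<N}. c y z \<le> a}"
        using that ab rel_trans[OF ab(2) x, of y] by auto
      then show ?thesis using card_class[OF ab(1)] that by simp
    qed
    show "c y y \<le> a" if "y \<in> ?X" for y
      using that rel_refl by simp
    show "c z y \<le> a" if "y \<in> ?X" "z \<in> ?X" "c y z \<le> a" for y z
      using that rel_sym by simp
    show "c u w \<le> a" if "u \<in> ?X" "v \<in> ?X" "w \<in> ?X" "c u v \<le> a" "c v w \<le> a" for u v w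
      using rel_trans[of a u v w] that ab by simp
  qed (simp_all add: class_size_pos)
  then obtain g where "\<forall>i<t. g i \<in> ?X" "\<forall>i<t. \<forall>j<t. c (g i) (g j) \<le> a \<longleftrightarrow> i = j"
    "\<forall>y\<in>?X. \<exists>i<t. c (g i) y \<le> a" by blast
  then show thesis by (intro that[of g]) auto
qed

text \<open>Base points for the two classes of \<open>c x y \<le> 3\<close>; one class will supply
  the rows of \<open>W\<close>, the other the columns.\<close>

definition halves :: "nat \<Rightarrow> nat \<Rightarrow> bool" where
  "halves x0 x1 \<longleftrightarrow> x0 < N \<and> x1 < N \<and> \<not> c x0 x1 \<le> 3 \<and> (\<forall>x<N. c x0 x \<le> 3 \<or> c x1 x \<le> 3)"

lemma halves_commute: "halves x0 x1 \<Longrightarrow> halves x1 x0"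
  by (auto simp: halves_def c_sym)

lemma ex_halves: obtains x0 x1 where "halves x0 x1"
proof -
  have "\<exists>g :: nat \<Rightarrow> nat. (\<forall>i<2. g i \<in> {..<N}) \<and> (\<forall>i<2. \<forall>j<2. c (g i) (g j) \<le> 3 \<longleftrightarrow> i = j) \<and>
           (\<forall>y\<in>{..<N}. \<exists>i<2. c (g i) y \<le> 3)"
  proof (rule ex_transversal[where s = "class_size 3" and R = "\<lambda>x y. c x y \<le> 3"])
    \<comment> \<open>The order \<open>4 * m * n\<close> is twice the class size
      \<open>2 * m * n\<close>, so there are exactly two halves.\<close>
    show "card {..<N} = class_size 3 * 2" by (simp add: N_eq class_size_def)
    show "card {z \<in> {..<N}. c y z \<le> 3} = class_size 3" if "y \<in> {..<N}" for y
      using card_class that by simp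
    show "c y y \<le> 3" if "y \<in> {..<N}" for y
      using that rel_refl by simp
    show "c z y \<le> 3" if "y \<in> {..<N}" "z \<in> {..<N}" "c y z \<le> 3" for y z
      using that rel_sym by simp
    show "c u w \<le> 3" if "u \<in> {..<N}" "v \<in> {..<N}" "w \<in> {..<N}" "c u v \<le> 3" "c v w \<le> 3" for u v w
      using rel_trans[of 3 u v w] that by simp
  qed (simp_all add: class_size_pos)
  then obtain g :: "nat \<Rightarrow> nat" where g: "\<forall>i<2. g i \<in> {..<N}" "\<forall>i<2. \<forall>j<2. c (g i) (g j) \<le> 3 \<longleftrightarrow> i = j"
    "\<forall>y\<in>{..<N}. \<exists>i<2. c (g i) y \<le> 3"
    by blast
  have "g 0 < N" "g 1 < N" using g(1) by simp_all
  moreover have "\<not> c (g 0) (g 1) \<le> 3" using g(2)[rule_format, of 0 1] by simp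
  moreover have "c (g 0) x \<le> 3 \<or> c (g 1) x \<le> 3" if "x < N" for x
  proof -
    obtain i where "i < 2" "c (g i) x \<le> 3" using g(3)[rule_format, of x] \<open>x < N\<close> by auto
    then show ?thesis by (auto dest: less_2_cases)
  qed
  ultimately have "halves (g 0) (g 1)" unfolding halves_def by blast
  then show thesis by (rule that)
qed

text \<open>The map \<open>e\<close> picks one point from each pair \<open>c x y \<le> 1\<close> in the half of \<open>x0\<close>, numbered so that
  the groups are the blocks of \<open>n\<close> consecutive indices, as for the matrix \<open>group_mat m n\<close>.\<close>

definition labelling :: "nat \<Rightarrow> (nat \<Rightarrow> nat) \<Rightarrow> bool" where
  "labelling x0 e \<longleftrightarrow> (\<forall>i<m * n. e i < N \<and> c x0 (e i) \<le> 3) \<and>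
     (\<forall>i<m * n. \<forall>j<m * n. (c (e i) (e j) \<le> 1 \<longleftrightarrow> i = j) \<and> (c (e i) (e j) \<le> 2 \<longleftrightarrow> i div n = j div n)) \<and>
     (\<forall>x<N. c x0 x \<le> 3 \<longrightarrow> (\<exists>i<m * n. c (e i) x \<le> 1))"

lemma ex_labelling:
  assumes x0: "x0 < N"
  obtains e where "labelling x0 e"
proof -
  obtain g where g: "\<And>a. a < m \<Longrightarrow> g a < N" "\<And>a. a < m \<Longrightarrow> c x0 (g a) \<le> 3"
    "\<And>a b. a < m \<Longrightarrow> b < m \<Longrightarrow> c (g a) (g b) \<le> 2 \<longleftrightarrow> a = b"
    "\<And>y. y < N \<Longrightarrow> c x0 y \<le> 3 \<Longrightarrow> \<exists>a<m. c (g a) y \<le> 2"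
    by (rule class_transversal[of 2 3 m x0]) (auto simp: class_size_def x0)
  \<comment> \<open>Packing the required properties into one predicate allows a single choice
    function to select the representatives in all \<open>m\<close> groups.\<close>
  define G where "G a h \<longleftrightarrow> (\<forall>i<n. h i < N \<and> c (g a) (h i) \<le> 2) \<and>
      (\<forall>i<n. \<forall>j<n. c (h i) (h j) \<le> 1 \<longleftrightarrow> i = j) \<and>
      (\<forall>y<N. c (g a) y \<le> 2 \<longrightarrow> (\<exists>i<n. c (h i) y \<le> 1))" for a h
  have "\<forall>a\<in>{..<m}. \<exists>h. G a h"
  proof
    fix a assume "a \<in> {..<m}"
    then obtain h where "\<And>i. i < n \<Longrightarrow> h i < N" "\<And>i. i < n \<Longrightarrow> c (g a) (h i) \<le> 2"
      "\<And>i j. i < n \<Longrightarrow> j < n \<Longrightarrow> c (h i) (h j) \<le> 1 \<longleftrightarrow> i = j"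
      "\<And>y. y < N \<Longrightarrow> c (g a) y \<le> 2 \<Longrightarrow> \<exists>i<n. c (h i) y \<le> 1"
      using class_transversal[of 1 2 n "g a"] g(1) by (auto simp: class_size_def)
    then show "\<exists>h. G a h" unfolding G_def by blast
  qed
  from bchoice[OF this] obtain h where "\<And>a. a < m \<Longrightarrow> G a (h a)" by auto
  then have h: "\<And>a i. a < m \<Longrightarrow> i < n \<Longrightarrow> h a i < N"
    "\<And>a i. a < m \<Longrightarrow> i < n \<Longrightarrow> c (g a) (h a i) \<le> 2"
    "\<And>a i j. a < m \<Longrightarrow> i < n \<Longrightarrow> j < n \<Longrightarrow> c (h a i) (h a j) \<le> 1 \<longleftrightarrow> i = j"
    "\<And>a y. a < m \<Longrightarrow> y < N \<Longrightarrow> c (g a) y \<le> 2 \<Longrightarrow> \<exists>i<n. c (h a i) y \<le> 1"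
    unfolding G_def by blast+
  have grp: "c (h a i) (h b j) \<le> 2 \<longleftrightarrow> a = b" if ab: "a < m" "b < m" and ij: "i < n" "j < n" for a b i j
  proof
    note tr = rel_trans[of 2, simplified]
    note N = g(1)[OF ab(1)] g(1)[OF ab(2)] h(1)[OF ab(1) ij(1)] h(1)[OF ab(2) ij(2)]
    note cl = h(2)[OF ab(1) ij(1)] h(2)[OF ab(2) ij(2)]
    show "a = b" if "c (h a i) (h b j) \<le> 2"
    proof -
      have "c (g a) (h b j) \<le> 2" by (rule tr[OF N(1,3,4) cl(1) that])
      then have "c (g a) (g b) \<le> 2" by (rule tr[OF N(1,4,2) _ rel_sym[OF N(2,4) cl(2)]])
      then show ?thesis using g(3) ab by blast
    qed
    show "c (h a i) (h b j) \<le> 2" if "a = b"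
      using tr[OF N(3,1,4) rel_sym[OF N(1,3) cl(1)]] cl(2) that by blast
  qed
  \<comment> \<open>The index \<open>i\<close> is read as position \<open>i mod n\<close> in group
    \<open>i div n\<close>, in agreement with the blocks of \<open>group_mat m n\<close>.\<close>
  define e where "e i = h (i div n) (i mod n)" for i
  have n0: "n > 0" using n by simp
  have dm: "i div n < m" "i mod n < n" if "i < m * n" for i
    using that n0 by (auto simp: less_mult_imp_div_less)
  have "e i < N \<and> c x0 (e i) \<le> 3" if "i < m * n" for i
  proof -
    have "c (g (i div n)) (e i) \<le> 3" using h(2)[OF dm[OF that]] by (simp add: e_def)
    then show ?thesis using rel_trans[of 3 x0 "g (i div n)" "e i"] g(1,2)[OF dm(1)[OF that]] h(1)[OF dm[OF that]] x0
      by (simp add: e_def)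
  qed
  moreover have "c (e i) (e j) \<le> 2 \<longleftrightarrow> i div n = j div n" if "i < m * n" "j < m * n" for i j
    unfolding e_def using grp dm that by blast
  moreover have "c (e i) (e j) \<le> 1 \<longleftrightarrow> i = j" if ij: "i < m * n" "j < m * n" for i j
  proof
    assume le: "c (e i) (e j) \<le> 1"
    then have "c (e i) (e j) \<le> 2" by simp
    then have d: "i div n = j div n" unfolding e_def using grp dm ij by blast
    then have "i mod n = j mod n" using le h(3) dm ij by (simp add: e_def)
    with d show "i = j" by (metis div_mult_mod_eq)
  qed (use h(1) dm ij in \<open>auto simp: e_def rel_refl\<close>)
  moreover have "\<exists>i<m * n. c (e i) x \<le> 1" if x: "x < N" "c x0 x \<le> 3" for x
  proof -
    obtain a where a: "a < m" "c (g a) x \<le> 2" using g(4)[OF x] by blast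
    obtain b where b: "b < n" "c (h a b) x \<le> 1" using h(4)[OF a(1) x(1) a(2)] by blast
    show ?thesis using a b n0 mult_add_less[OF a(1) b(1)]
      by (intro exI[of _ "a * n + b"]) (simp add: e_def)
  qed
  ultimately have "labelling x0 e" unfolding labelling_def by blast
  then show thesis by (rule that)
qed

section \<open>From sums over all points to sums over representatives of one half\<close>

lemma sum_half:
  fixes F :: "nat \<Rightarrow> real"
  assumes e: "labelling x0 e" and x0: "x0 < N"
    and inv: "\<And>x y. x < N \<Longrightarrow> y < N \<Longrightarrow> c x y \<le> 1 \<Longrightarrow> F x = F y"
    and supp: "\<And>x. x < N \<Longrightarrow> \<not> c x0 x \<le> 3 \<Longrightarrow> F x = 0"
  shows "(\<Sum>i<m * n. F (e i)) = (\<Sum>x<N. F x) / 2"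
proof -
  have eN: "e i < N" "c x0 (e i) \<le> 3" if "i < m * n" for i
    using e that by (auto simp: labelling_def)
  \<comment> \<open>In the half of \<open>x0\<close> exactly one label is paired with
    \<open>x\<close>; outside it there is none and \<open>F x\<close> is 0. After exchanging the
    sums every label counts twice, once for each point of its pair.\<close>
  have "F x = (\<Sum>i<m * n. of_bool (c (e i) x \<le> 1) * F (e i))" if x: "x < N" for x
  proof (cases "c x0 x \<le> 3")
    case True
    then obtain i where i: "i < m * n" "c (e i) x \<le> 1" using e x by (auto simp: labelling_def)
    have "c (e j) x \<le> 1 \<longleftrightarrow> j = i" if j: "j < m * n" for j
    proof -
      have "c (e j) x \<le> 1 \<longleftrightarrow> c (e j) (e i) \<le> 1"
        using rel_trans[of 1 "e j" x "e i"] rel_trans[of 1 "e j" "e i" x] rel_sym[of "e i" x 1] i j eN x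
        by (auto simp del: One_nat_def)
      then show ?thesis using e i j by (auto simp: labelling_def)
    qed
    then have "(\<Sum>j<m * n. of_bool (c (e j) x \<le> 1) * F (e j)) = (\<Sum>j<m * n. if j = i then F (e j) else 0)"
      by (intro sum.cong) auto
    also have "\<dots> = F (e i)" using i by simp
    also have "\<dots> = F x" using inv i eN x by blast
    finally show ?thesis by simp
  next
    case False
    have "\<not> c (e i) x \<le> 1" if "i < m * n" for i
      using False rel_trans[of 3 x0 "e i" x] eN[OF that] x x0 by auto
    then show ?thesis using supp[OF x False] by simp
  qed
  then have "(\<Sum>x<N. F x) = (\<Sum>x<N. \<Sum>i<m * n. of_bool (c (e i) x \<le> 1) * F (e i))" by simp
  also have "\<dots> = (\<Sum>i<m * n. (\<Sum>x<N. of_bool (c (e i) x \<le> 1)) * F (e i))"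
    by (subst sum.swap) (simp add: sum_distrib_right)
  also have "\<dots> = (\<Sum>i<m * n. 2 * F (e i))"
  proof (intro sum.cong refl)
    fix i assume "i \<in> {..<m * n}"
    then have "card {x \<in> {..<N}. c (e i) x \<le> 1} = 2" using card_class[of 1] eN by (simp add: class_size_def)
    moreover have "(\<Sum>x<N. of_bool (c (e i) x \<le> 1)) = real (card {x \<in> {..<N}. c (e i) x \<le> 1})"
      by (subst sum_of_bool_eq) (auto intro: arg_cong[where f = card])
    ultimately show "(\<Sum>x<N. of_bool (c (e i) x \<le> 1)) * F (e i) = 2 * F (e i)" by simp
  qed
  finally show ?thesis by (simp add: sum_distrib_left[symmetric])
qed

text \<open>Classes of \<open>c x y \<le> 1\<close> have two elements, so the class of
  \<open>x\<close> is \<open>{x, x'}\<close>, and \<open>pair_sgn_convolution\<close> says that the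
  two values add up to 0.\<close>

lemma sgn_rel_pair:
  assumes N: "x < N" "x' < N" "y < N" and x': "c x x' = 1"
  shows "sgn_rel (c x' y) = - sgn_rel (c x y)"
proof -
  have "x \<noteq> x'" using x' c_0 N by force
  have "{x, x'} = {z \<in> {..<N}. c x z \<le> 1}"
    using N x' rel_refl card_class[of 1 x] \<open>x \<noteq> x'\<close>
    by (intro card_seteq) (auto simp: class_size_def)
  then have "(\<Sum>z<N. of_bool (c x z \<le> 1) * sgn_rel (c z y)) = (\<Sum>z\<in>{x, x'}. sgn_rel (c z y))"
    by (simp add: of_bool_def if_distrib[of "\<lambda>t. t * _"] sum.If_cases Int_def cong: if_cong)
  then show ?thesis using pair_sgn_convolution[OF N(1,3)] \<open>x \<noteq> x'\<close> by simp
qed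

lemma sgn_rel_pair_cases:
  assumes "x < N" "x' < N" "y < N" "c x x' \<le> 1"
  shows "x = x' \<or> sgn_rel (c x' y) = - sgn_rel (c x y)"
  using sgn_rel_pair[OF assms(1-3)] c_0[OF assms(1,2)] assms(4) by linarith

text \<open>Each summand agrees on the two points of a pair, since two sign changes cancel and
  absolute values hide them, and it vanishes outside the half of \<open>x1\<close>. Hence
  \<open>sum_half\<close> makes each sum half of a convolution already computed.\<close>

lemma half_products:
  assumes h: "halves x0 x1" and e: "labelling x0 e" and e': "labelling x1 e'"
    and i: "i < m * n" and j: "j < m * n"
  shows "(\<Sum>l<m * n. sgn_rel (c (e i) (e' l)) * sgn_rel (c (e j) (e' l))) = real k * of_bool (i = j)"
    and "(\<Sum>l<m * n. \<bar>sgn_rel (c (e i) (e' l))\<bar> * \<bar>sgn_rel (c (e j) (e' l))\<bar>) =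
      (if i = j then real k else if i div n = j div n then mu1 else mu2)"
    and "(\<Sum>l<m * n. \<bar>sgn_rel (c (e i) (e' l))\<bar> * of_bool (l div n = j div n)) = real k / real m"
proof -
  have x: "x0 < N" "x1 < N" using h by (auto simp: halves_def)
  have eN: "e l < N" "c x0 (e l) \<le> 3" "e' l < N" "c x1 (e' l) \<le> 3" if "l < m * n" for l
    using e e' that by (auto simp: labelling_def)
  have ij: "c (e i) (e j) \<le> 1 \<longleftrightarrow> i = j" "c (e i) (e j) \<le> 2 \<longleftrightarrow> i div n = j div n"
    using e i j by (auto simp: labelling_def)
  \<comment> \<open>Distinct representatives are never paired, so relation 1 does not occur between
    them and its term in \<open>sgn_sgn_convolution\<close> drops out.\<close>
  have ij0: "c (e i) (e j) = 0 \<longleftrightarrow> i = j" using c_0[OF eN(1)[OF i] eN(1)[OF j]] ij(1) by auto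
  \<comment> \<open>Both points lie in the half of \<open>x0\<close>; this excludes the final case 0
    of \<open>abs_abs_convolution\<close>.\<close>
  have ij3: "c (e i) (e j) \<le> 3"
    using rel_trans[of 3 "e i" x0 "e j"] eN[OF i] eN[OF j] x rel_sym[of x0 "e i" 3] by auto
  \<comment> \<open>Such a \<open>z\<close> lies in the same half as \<open>e i\<close>, where only
    the relations 0 to 3 occur.\<close>
  have supp: "sgn_rel (c (e i) z) = 0" if "z < N" "\<not> c x1 z \<le> 3" for z
  proof -
    have "c x0 z \<le> 3" using h that by (auto simp: halves_def)
    then have "c (e i) z \<le> 3" using rel_trans[of 3 "e i" x0 z] eN[OF i] x that rel_sym[of x0 "e i" 3] by auto
    then show ?thesis by (simp add: sgn_rel_def)
  qed
  have inv: "z = z' \<or> sgn_rel (c y z') = - sgn_rel (c y z)" if "z < N" "z' < N" "y < N" "c z z' \<le> 1" for y z z'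
    using sgn_rel_pair_cases[OF that(1,2,3,4)] c_sym[OF that(1,3)] c_sym[OF that(2,3)] by auto
  have sw: "c (e j) (e' l) = c (e' l) (e j)" if "l < m * n" for l
    using c_sym eN that j by simp
  have "(\<Sum>l<m * n. sgn_rel (c (e i) (e' l)) * sgn_rel (c (e' l) (e j))) =
      (\<Sum>z<N. sgn_rel (c (e i) z) * sgn_rel (c z (e j))) / 2"
  proof (rule sum_half[OF e' x(2)])
    fix z z' assume "z < N" "z' < N" "c z z' \<le> 1"
    then show "sgn_rel (c (e i) z) * sgn_rel (c z (e j)) = sgn_rel (c (e i) z') * sgn_rel (c z' (e j))"
      using inv[of z z' "e i"] sgn_rel_pair_cases[of z z' "e j"] eN[OF i] eN[OF j] by auto
  qed (simp add: supp)
  then show "(\<Sum>l<m * n. sgn_rel (c (e i) (e' l)) * sgn_rel (c (e j) (e' l))) = real k * of_bool (i = j)"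
    using ij ij0 by (auto simp: sw sgn_sgn_convolution eN i j)
  have "(\<Sum>l<m * n. \<bar>sgn_rel (c (e i) (e' l))\<bar> * \<bar>sgn_rel (c (e' l) (e j))\<bar>) =
      (\<Sum>z<N. \<bar>sgn_rel (c (e i) z)\<bar> * \<bar>sgn_rel (c z (e j))\<bar>) / 2"
  proof (rule sum_half[OF e' x(2)])
    fix z z' assume "z < N" "z' < N" "c z z' \<le> 1"
    then show "\<bar>sgn_rel (c (e i) z)\<bar> * \<bar>sgn_rel (c z (e j))\<bar> = \<bar>sgn_rel (c (e i) z')\<bar> * \<bar>sgn_rel (c z' (e j))\<bar>"
      using inv[of z z' "e i"] sgn_rel_pair_cases[of z z' "e j"] eN[OF i] eN[OF j] by auto
  qed (simp add: supp)
  then show "(\<Sum>l<m * n. \<bar>sgn_rel (c (e i) (e' l))\<bar> * \<bar>sgn_rel (c (e j) (e' l))\<bar>) =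
      (if i = j then real k else if i div n = j div n then mu1 else mu2)"
    using ij ij3 by (auto simp: sw abs_abs_convolution eN i j)
  have gr: "c (e' l) (e' j) \<le> 2 \<longleftrightarrow> l div n = j div n" if "l < m * n" for l
    using e' j that by (auto simp: labelling_def)
  have inv2: "c z y \<le> 2 \<longleftrightarrow> c z' y \<le> 2" if "z < N" "z' < N" "y < N" "c z z' \<le> 1" for y z z'
    using rel_trans[of 2 z z' y] rel_trans[of 2 z' z y] rel_sym[of z z' 1] that by auto
  \<comment> \<open>The two points lie in different halves, so only relations 4, 5 and 6 are
    possible. On these \<open>abs_group_convolution\<close> is constant, which makes the sum
    independent of \<open>i\<close> and \<open>j\<close>.\<close>
  have "\<not> c (e i) (e' j) \<le> 3"
  proof
    assume "c (e i) (e' j) \<le> 3"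
    then have "c x0 (e' j) \<le> 3" using rel_trans[of 3 x0 "e i" "e' j"] eN[OF i] eN[OF j] x by simp
    then have "c x0 x1 \<le> 3" using rel_trans[of 3 x0 "e' j" x1] eN[OF i] eN[OF j] x rel_sym[of x1 "e' j" 3] by simp
    then show False using h by (simp add: halves_def)
  qed
  moreover have "c (e i) (e' j) \<le> 6" using c_le eN i j by simp
  moreover have "(\<Sum>l<m * n. \<bar>sgn_rel (c (e i) (e' l))\<bar> * of_bool (c (e' l) (e' j) \<le> 2)) =
      (\<Sum>z<N. \<bar>sgn_rel (c (e i) z)\<bar> * of_bool (c z (e' j) \<le> 2)) / 2"
  proof (rule sum_half[OF e' x(2)])
    fix z z' assume "z < N" "z' < N" "c z z' \<le> 1"
    then show "\<bar>sgn_rel (c (e i) z)\<bar> * of_bool (c z (e' j) \<le> 2) = \<bar>sgn_rel (c (e i) z')\<bar> * of_bool (c z' (e' j) \<le> 2)"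
      using inv[of z z' "e i"] inv2[of z z' "e' j"] eN[OF i] eN[OF j] by auto
  qed (simp add: supp)
  ultimately show "(\<Sum>l<m * n. \<bar>sgn_rel (c (e i) (e' l))\<bar> * of_bool (l div n = j div n)) = real k / real m"
    unfolding abs_group_convolution[OF eN(1)[OF i] eN(3)[OF j]]
    by (simp add: gr del: sum_mult_of_bool_eq)
qed

section \<open>Assembly of the weighing matrix\<close>

lemma abs_sgn_rel: "\<bar>sgn_rel a\<bar> = real (of_bool (a = 4 \<or> a = 5))"
  by (simp add: sgn_rel_def)

lemma ex_weighing_matrix:
  "\<exists>W :: real mat.
     quasi_balanced_weighing_matrix (m * n) k W \<and>
     (\<exists>lam1 lam2. symmetric_gdd (m * n) k m n lam1 lam2 (abs_mat W)) \<and>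
     abs_mat W * group_mat m n = group_mat m n * abs_mat W \<and>
     group_mat m n * abs_mat W = (real k / real m) \<cdot>\<^sub>m all_ones_mat (m * n)"
proof -
  obtain x0 x1 where h: "halves x0 x1" by (rule ex_halves)
  then have x: "x0 < N" "x1 < N" by (auto simp: halves_def)
  obtain e where e: "labelling x0 e" using ex_labelling[OF x(1)] .
  obtain e' where e': "labelling x1 e'" using ex_labelling[OF x(2)] .
  have eN: "e l < N" "e' l < N" if "l < m * n" for l
    using e e' that by (auto simp: labelling_def)
  let ?M = "m * n"
  define s where "s i j = sgn_rel (c (e i) (e' j))" for i j
  have s_swap: "sgn_rel (c (e' j) (e i)) = s i j" if "i < ?M" "j < ?M" for i j
    using c_sym[OF eN(1)[OF that(1)] eN(2)[OF that(2)]] by (simp add: s_def)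
  define \<mu> where "\<mu> i j = (if i = j then real k else if i div n = j div n then mu1 else mu2)" for i j
  note rows = half_products[OF h e e', folded s_def]
  \<comment> \<open>Interchanging the two halves transposes \<open>W\<close>, so
    \<open>half_products\<close> applied to \<open>x1\<close> and \<open>x0\<close> yields the
    column identities.\<close>
  have col: "(\<Sum>l<?M. \<bar>s l i\<bar> * \<bar>s l j\<bar>) = \<mu> i j" "(\<Sum>l<?M. of_bool (i div n = l div n) * \<bar>s l j\<bar>) = real k / real m"
    if "i < ?M" "j < ?M" for i j
  proof -
    have "(\<Sum>l<?M. \<bar>s l i\<bar> * \<bar>s l j\<bar>) = (\<Sum>l<?M. \<bar>sgn_rel (c (e' i) (e l))\<bar> * \<bar>sgn_rel (c (e' j) (e l))\<bar>)"
      by (rule sum.cong) (simp_all add: s_swap that)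
    then show "(\<Sum>l<?M. \<bar>s l i\<bar> * \<bar>s l j\<bar>) = \<mu> i j"
      unfolding half_products(2)[OF halves_commute[OF h] e' e that] \<mu>_def .
    have "(\<Sum>l<?M. of_bool (i div n = l div n) * \<bar>s l j\<bar>) =
        (\<Sum>l<?M. \<bar>sgn_rel (c (e' j) (e l))\<bar> * of_bool (l div n = i div n))"
      by (rule sum.cong) (auto simp: s_swap that)
    then show "(\<Sum>l<?M. of_bool (i div n = l div n) * \<bar>s l j\<bar>) = real k / real m"
      unfolding half_products(3)[OF halves_commute[OF h] e' e that(2,1)] .
  qed
  \<comment> \<open>Each value counts the columns in which both rows are nonzero. Hence
    \<open>mu1\<close> and \<open>mu2\<close>, defined as reals, are natural numbers, as
    \<open>symmetric_gdd\<close> demands.\<close>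
  have nat: "\<exists>a :: nat. \<mu> i j = real a" if "i < ?M" "j < ?M" for i j
  proof -
    have "\<mu> i j = real (\<Sum>l<?M. of_bool (c (e i) (e' l) = 4 \<or> c (e i) (e' l) = 5) *
        of_bool (c (e j) (e' l) = 4 \<or> c (e j) (e' l) = 5))"
      unfolding \<mu>_def rows(2)[OF that, symmetric] of_nat_sum of_nat_mult s_def abs_sgn_rel ..
    then show ?thesis by blast
  qed
  \<comment> \<open>Indices 0 and 1 share a block while 0 and \<open>n\<close> do not, so both
    \<open>mu1\<close> and \<open>mu2\<close> occur as entries.\<close>
  have n_less: "1 < ?M" "n < ?M" using mult_le_mono1[OF m, of n] n by linarith+
  have "\<mu> 0 1 = mu1" using n by (simp add: \<mu>_def)
  then obtain lam1 :: nat where lam1: "mu1 = lam1" using nat[of 0 1] n_less by auto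
  have "\<mu> 0 n = mu2" using n by (simp add: \<mu>_def)
  then obtain lam2 :: nat where lam2: "mu2 = lam2" using nat[of 0 n] n_less by auto
  define W where "W = mat ?M ?M (\<lambda>(i, j). s i j)"
  have aW: "abs_mat W = mat ?M ?M (\<lambda>(i, j). \<bar>s i j\<bar>)"
    by (rule eq_matI) (simp_all add: W_def abs_mat_def)
  have WW: "W * W\<^sup>T = of_nat k \<cdot>\<^sub>m 1\<^sub>m ?M"
    unfolding W_def transpose_mat_mat mat_mult_mat by (rule eq_matI) (simp_all add: rows(1))
  have AA: "abs_mat W * (abs_mat W)\<^sup>T = mat ?M ?M (\<lambda>(i, j). \<mu> i j)"
    unfolding aW transpose_mat_mat mat_mult_mat by (rule eq_matI) (simp_all add: rows(2) \<mu>_def)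
  have AA': "(abs_mat W)\<^sup>T * abs_mat W = mat ?M ?M (\<lambda>(i, j). \<mu> i j)"
    unfolding aW transpose_mat_mat mat_mult_mat by (rule eq_matI) (simp_all add: col(1))
  have AG: "abs_mat W * group_mat m n = (real k / real m) \<cdot>\<^sub>m all_ones_mat ?M"
    unfolding aW group_mat_eq mat_mult_mat
    by (rule eq_matI) (simp_all add: rows(3) all_ones_mat_def del: sum_mult_of_bool_eq)
  have GA: "group_mat m n * abs_mat W = (real k / real m) \<cdot>\<^sub>m all_ones_mat ?M"
    unfolding aW group_mat_eq mat_mult_mat
    by (rule eq_matI) (simp_all add: col(2) all_ones_mat_def del: sum_of_bool_mult_eq)
  have s_cases: "s i j \<in> {0, 1, -1}" for i j by (simp add: s_def sgn_rel_def)
  have "weighing_matrix ?M k W"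
    using s_cases by (auto simp: weighing_matrix_def WW) (auto simp: W_def elements_mat_def)
  moreover have "card {(abs_mat W * (abs_mat W)\<^sup>T) $$ (i, j) | i j. i < ?M \<and> j < ?M \<and> i \<noteq> j} \<le> 2"
  proof -
    have "{(abs_mat W * (abs_mat W)\<^sup>T) $$ (i, j) | i j. i < ?M \<and> j < ?M \<and> i \<noteq> j} \<subseteq> {mu1, mu2}"
      by (auto simp: AA \<mu>_def)
    then have "card {(abs_mat W * (abs_mat W)\<^sup>T) $$ (i, j) | i j. i < ?M \<and> j < ?M \<and> i \<noteq> j} \<le> card {mu1, mu2}"
      by (intro card_mono) auto
    also have "\<dots> \<le> 2" by (simp add: card_insert_if)
    finally show ?thesis .
  qed
  ultimately have "quasi_balanced_weighing_matrix ?M k W"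
    unfolding quasi_balanced_weighing_matrix_def using AA AA' by simp
  moreover have "symmetric_gdd ?M k m n lam1 lam2 (abs_mat W)"
    unfolding symmetric_gdd_def
  proof (intro conjI)
    show "abs_mat W \<in> carrier_mat ?M ?M" by (simp add: aW)
    show "elements_mat (abs_mat W) \<subseteq> {0, 1}"
      using abs_sgn_rel by (auto simp: aW elements_mat_def s_def)
    show "(abs_mat W)\<^sup>T * abs_mat W = of_nat k \<cdot>\<^sub>m 1\<^sub>m ?M + of_nat lam1 \<cdot>\<^sub>m (group_mat m n - 1\<^sub>m ?M)
                + of_nat lam2 \<cdot>\<^sub>m (all_ones_mat ?M - group_mat m n)"
      unfolding AA' group_mat_eq
      by (rule eq_matI) (auto simp: \<mu>_def lam1 lam2 all_ones_mat_def)
  qed (use m n AA AA' in auto)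
  ultimately show ?thesis using AG GA by (intro exI[of _ W]) auto
qed

end

section \<open>Multiplication in the Bose-Mesner algebra and orthogonality of its
  idempotents\<close>

lemma mat_lincomb_mult:
  assumes B: "\<And>i. i \<le> d \<Longrightarrow> B i \<in> carrier_mat N N"
    and q: "\<And>i j. i \<le> d \<Longrightarrow> j \<le> d \<Longrightarrow> B i * B j = mat_lincomb N d (q i j) B"
  shows "mat_lincomb N d a B * mat_lincomb N d b B =
    mat_lincomb N d (\<lambda>h. \<Sum>i\<le>d. \<Sum>j\<le>d. a i * b j * q i j h) B"
proof (rule eq_matI)
  fix x y assume "x < dim_row (mat_lincomb N d (\<lambda>h. \<Sum>i\<le>d. \<Sum>j\<le>d. a i * b j * q i j h) B)"
    "y < dim_col (mat_lincomb N d (\<lambda>h. \<Sum>i\<le>d. \<Sum>j\<le>d. a i * b j * q i j h) B)"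
  then have xy: "x < N" "y < N" by (simp_all add: mat_lincomb_def)
  have prod: "(\<Sum>z<N. B i $$ (x, z) * B j $$ (z, y)) = (\<Sum>h\<le>d. q i j h * B h $$ (x, y))" if "i \<le> d" "j \<le> d" for i j
  proof -
    have "(\<Sum>z<N. B i $$ (x, z) * B j $$ (z, y)) = (B i * B j) $$ (x, y)"
      using B[OF that(1)] B[OF that(2)] xy by (simp add: scalar_prod_def lessThan_atLeast0)
    then show ?thesis using q[OF that] xy by (simp add: mat_lincomb_def)
  qed
  have "(mat_lincomb N d a B * mat_lincomb N d b B) $$ (x, y) =
      (\<Sum>z<N. (\<Sum>i\<le>d. a i * B i $$ (x, z)) * (\<Sum>j\<le>d. b j * B j $$ (z, y)))"
    using xy by (simp add: mat_lincomb_def mat_mult_mat)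
  also have "\<dots> = (\<Sum>z<N. \<Sum>i\<le>d. \<Sum>j\<le>d. a i * b j * (B i $$ (x, z) * B j $$ (z, y)))"
    by (simp add: sum_product mult_ac)
  also have "\<dots> = (\<Sum>i\<le>d. \<Sum>j\<le>d. a i * b j * (\<Sum>z<N. B i $$ (x, z) * B j $$ (z, y)))"
    by (rule trans[OF sum.swap], rule sum.cong[OF refl], rule trans[OF sum.swap]) (simp add: sum_distrib_left)
  also have "\<dots> = (\<Sum>i\<le>d. \<Sum>j\<le>d. \<Sum>h\<le>d. a i * b j * q i j h * B h $$ (x, y))"
    by (simp add: prod sum_distrib_left mult.assoc)
  also have "\<dots> = (\<Sum>i\<le>d. \<Sum>h\<le>d. \<Sum>j\<le>d. a i * b j * q i j h * B h $$ (x, y))"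
    by (rule sum.cong[OF refl], rule sum.swap)
  also have "\<dots> = (\<Sum>h\<le>d. (\<Sum>i\<le>d. \<Sum>j\<le>d. a i * b j * q i j h) * B h $$ (x, y))"
    unfolding sum_distrib_right by (rule sum.swap)
  finally show "(mat_lincomb N d a B * mat_lincomb N d b B) $$ (x, y) =
      mat_lincomb N d (\<lambda>h. \<Sum>i\<le>d. \<Sum>j\<le>d. a i * b j * q i j h) B $$ (x, y)"
    using xy by (simp add: mat_lincomb_def)
qed (simp_all add: mat_lincomb_def)

lemma mat_lincomb_carrier: "mat_lincomb N d a B \<in> carrier_mat N N"
  by (simp add: mat_lincomb_def)

lemma mat_lincomb_cong:
  assumes "\<And>i. i \<le> d \<Longrightarrow> a i = b i"
  shows "mat_lincomb N d a B = mat_lincomb N d b B"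
  unfolding mat_lincomb_def using assms by (intro cong_mat) (auto intro!: sum.cong)

lemma mat_lincomb_diff:
  "mat_lincomb N d a B - mat_lincomb N d b B = mat_lincomb N d (\<lambda>i. a i - b i) B"
  by (rule eq_matI) (simp_all add: mat_lincomb_def sum_subtractf algebra_simps)

lemma mat_lincomb_unit:
  assumes "i \<le> d" "B i \<in> carrier_mat N N"
  shows "mat_lincomb N d (\<lambda>j. of_bool (j = i)) B = B i"
  using assms by (intro eq_matI) (auto simp: mat_lincomb_def if_distrib[of "\<lambda>t. t * _"] of_bool_def cong: if_cong)

text \<open>By commutativity \<open>e * f\<close> is idempotent, and
  \<open>e = e * f + (e - e * f)\<close> is a sum of orthogonal idempotents. Primitivity of
  \<open>e\<close> makes \<open>e * f\<close> either 0 or \<open>e\<close>; by symmetry a nonzero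
  product would equal both \<open>e\<close> and \<open>f\<close>.\<close>

lemma primitive_idempotent_orthogonal:
  assumes S: "S \<subseteq> carrier_mat N N"
    and mult: "\<And>X Y. X \<in> S \<Longrightarrow> Y \<in> S \<Longrightarrow> X * Y \<in> S"
    and diff: "\<And>X Y. X \<in> S \<Longrightarrow> Y \<in> S \<Longrightarrow> X - Y \<in> S"
    and comm: "\<And>X Y. X \<in> S \<Longrightarrow> Y \<in> S \<Longrightarrow> X * Y = Y * X"
    and e: "primitive_idempotent N S e" and f: "primitive_idempotent N S f" and "e \<noteq> f"
  shows "e * f = 0\<^sub>m N N"
proof (rule ccontr)
  assume nz: "e * f \<noteq> 0\<^sub>m N N"
  have absorb: "e * f = e" if e: "primitive_idempotent N S e" and f: "primitive_idempotent N S f"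
    and nz: "e * f \<noteq> 0\<^sub>m N N" for e f
  proof (rule ccontr)
    assume ne: "e * f \<noteq> e"
    have ef: "e \<in> S" "f \<in> S" "e * e = e" "f * f = f"
      using e f by (auto simp: primitive_idempotent_def)
    let ?g = "e * f"
    have g: "?g \<in> S" using mult ef by blast
    have car: "e \<in> carrier_mat N N" "f \<in> carrier_mat N N" "?g \<in> carrier_mat N N" using S ef g by blast+
    have eg: "e * ?g = ?g" using car ef(3) by (metis assoc_mult_mat)
    have ge: "?g * e = ?g" using comm[OF g ef(1)] eg by simp
    have gg: "?g * ?g = ?g"
    proof -
      have "?g * ?g = (?g * e) * f" using car by (metis assoc_mult_mat)
      also have "\<dots> = e * (f * f)" unfolding ge using car by (metis assoc_mult_mat)
      finally show ?thesis by (simp add: ef)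
    qed
    have d: "e - ?g \<in> S" using diff ef g by blast
    have gd: "?g * (e - ?g) = 0\<^sub>m N N"
      using car by (subst mult_minus_distrib_mat[of _ N N _ N]) (auto simp: ge gg)
    have dg: "(e - ?g) * ?g = 0\<^sub>m N N" using comm[OF d g] gd by simp
    have "(e - ?g) * (e - ?g) = (e - ?g) * e - (e - ?g) * ?g"
      using car d S by (intro mult_minus_distrib_mat[of _ N N _ N]) auto
    also have "\<dots> = (e - ?g) * e" unfolding dg using car by (intro eq_matI) auto
    also have "\<dots> = e - ?g" using car by (subst minus_mult_distrib_mat[of _ N N _ _ N]) (auto simp: ge ef)
    finally have dd: "(e - ?g) * (e - ?g) = e - ?g" .
    have sum: "e = ?g + (e - ?g)" using car by (intro eq_matI) auto
    have "e - ?g \<noteq> 0\<^sub>m N N"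
    proof
      assume "e - ?g = 0\<^sub>m N N"
      then have "e = ?g + 0\<^sub>m N N" using sum by simp
      then show False using ne car by simp
    qed
    then show False
      using e g d gg dd nz gd dg sum unfolding primitive_idempotent_def by blast
  qed
  have "e * f = f * e" using e f comm by (auto simp: primitive_idempotent_def)
  then show False using absorb[OF e f nz] absorb[OF f e] nz \<open>e \<noteq> f\<close> by simp
qed

lemma scheme_span_mult:
  assumes "symmetric_association_scheme N d A" "X \<in> mat_span N d A" "Y \<in> mat_span N d A"
  shows "X * Y \<in> mat_span N d A"
proof -
  obtain p :: "nat \<Rightarrow> nat \<Rightarrow> nat \<Rightarrow> nat" where
    "\<And>i j. i \<le> d \<Longrightarrow> j \<le> d \<Longrightarrow> A i * A j = mat_lincomb N d (\<lambda>h. of_nat (p i j h)) A"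
    using assms(1) unfolding symmetric_association_scheme_def by blast
  then show ?thesis
    using mat_lincomb_mult[of d A N "\<lambda>i j h. of_nat (p i j h)"] assms
    by (fastforce simp: mat_span_def symmetric_association_scheme_def)
qed

lemma scheme_span_symmetric:
  assumes "symmetric_association_scheme N d A" "X \<in> mat_span N d A"
  shows "X\<^sup>T = X"
proof -
  have "A i $$ (y, x) = A i $$ (x, y)" if "i \<le> d" "x < N" "y < N" for i x y
  proof -
    have "(A i)\<^sup>T = A i" "A i \<in> carrier_mat N N"
      using assms(1) \<open>i \<le> d\<close> by (auto simp: symmetric_association_scheme_def)
    then show ?thesis using that by (metis carrier_matD index_transpose_mat(1))
  qed
  then show ?thesis
    using assms(2) by (auto simp: mat_span_def mat_lincomb_def transpose_mat_mat intro!: eq_matI sum.cong)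
qed

text \<open>The product lies in the span, so it is symmetric like its factors, and transposing it
  reverses their order.\<close>

lemma scheme_span_commute:
  assumes "symmetric_association_scheme N d A" "X \<in> mat_span N d A" "Y \<in> mat_span N d A"
  shows "X * Y = Y * X"
proof -
  have "X \<in> carrier_mat N N" "Y \<in> carrier_mat N N"
    using assms(2,3) by (auto simp: mat_span_def mat_lincomb_def)
  then have "(X * Y)\<^sup>T = Y\<^sup>T * X\<^sup>T" by (rule transpose_mult)
  then show ?thesis
    using scheme_span_symmetric[OF assms(1)] scheme_span_mult[OF assms] assms by metis
qed

text \<open>Orthogonality kills all cross terms. This turns matrix products into products of
  eigenvalues.\<close>

lemma idempotent_lincomb_mult:
  assumes A: "symmetric_association_scheme N d A" and E: "primitive_idempotent_basis N d A E"
  shows "mat_lincomb N d a E * mat_lincomb N d b E = mat_lincomb N d (\<lambda>i. a i * b i) E"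
proof -
  have prim: "primitive_idempotent N (mat_span N d A) (E i)" if "i \<le> d" for i
    using E that by (auto simp: primitive_idempotent_basis_def)
  have span: "mat_span N d A \<subseteq> carrier_mat N N" by (auto simp: mat_span_def mat_lincomb_carrier)
  have car: "E i \<in> carrier_mat N N" if "i \<le> d" for i
    using prim[OF that] span by (auto simp: primitive_idempotent_def)
  \<comment> \<open>Orthogonality concerns distinct idempotents; linear independence ensures that
    distinct indices give distinct ones.\<close>
  have inj: "E i \<noteq> E j" if "i \<le> d" "j \<le> d" "i \<noteq> j" for i j
  proof
    assume "E i = E j"
    then have "mat_lincomb N d (\<lambda>l. of_bool (l = i)) E - mat_lincomb N d (\<lambda>l. of_bool (l = j)) E = 0\<^sub>m N N"
      using car that by (simp add: mat_lincomb_unit)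
    then have "\<forall>l\<le>d. of_bool (l = i) - of_bool (l = j) = (0::complex)"
      using E unfolding mat_lincomb_diff primitive_idempotent_basis_def by blast
    then show False using that by auto
  qed
  have diff: "X - Y \<in> mat_span N d A" if "X \<in> mat_span N d A" "Y \<in> mat_span N d A" for X Y
    using that unfolding mat_span_def by (auto simp: mat_lincomb_diff)
  have "E i * E j = mat_lincomb N d (\<lambda>h. of_bool (i = j \<and> h = i)) E" if "i \<le> d" "j \<le> d" for i j
  proof (cases "i = j")
    case True
    then show ?thesis using prim that car by (simp add: mat_lincomb_unit primitive_idempotent_def)
  next
    case False
    have "E i * E j = 0\<^sub>m N N"
      by (rule primitive_idempotent_orthogonal[OF span scheme_span_mult[OF A] diff scheme_span_commute[OF A]
            prim[OF that(1)] prim[OF that(2)] inj[OF that False]])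
    also have "\<dots> = mat_lincomb N d (\<lambda>h. of_bool (i = j \<and> h = i)) E"
      using False by (intro eq_matI) (simp_all add: mat_lincomb_def)
    finally show ?thesis .
  qed
  from mat_lincomb_mult[OF car this]
  have "mat_lincomb N d a E * mat_lincomb N d b E =
    mat_lincomb N d (\<lambda>h. \<Sum>i\<le>d. \<Sum>j\<le>d. a i * b j * of_bool (i = j \<and> h = i)) E" by blast
  also have "\<dots> = mat_lincomb N d (\<lambda>i. a i * b i) E"
  proof -
    have "(\<Sum>i\<le>d. \<Sum>j\<le>d. a i * b j * of_bool (i = j \<and> h = i)) = a h * b h" if "h \<le> d" for h
    proof -
      have "(\<Sum>i\<le>d. \<Sum>j\<le>d. a i * b j * of_bool (i = j \<and> h = i)) =
          (\<Sum>i\<le>d. \<Sum>j\<le>d. if j = i then if i = h then a i * b j else 0 else 0)"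
        by (intro sum.cong) auto
      then show ?thesis using that by (simp add: sum.delta)
    qed
    then show ?thesis by (rule mat_lincomb_cong)
  qed
  finally show ?thesis .
qed

section \<open>From the scheme to the relation function\<close>

lemma scheme_relation:
  assumes A: "symmetric_association_scheme N d A" and xy: "x < N" "y < N"
  shows "\<exists>!i. i \<le> d \<and> A i $$ (x, y) = 1" and "i \<le> d \<Longrightarrow> A i $$ (x, y) \<in> {0, 1}"
proof -
  show 01: "A i $$ (x, y) \<in> {0, 1}" if "i \<le> d" for i
  proof -
    have "A i \<in> carrier_mat N N" "elements_mat (A i) \<subseteq> {0, 1}"
      using A that by (auto simp: symmetric_association_scheme_def)
    then show ?thesis using elements_matI[OF _ xy refl] by blast
  qed
  have "mat_lincomb N d (\<lambda>_. 1) A $$ (x, y) = all_ones_mat N $$ (x, y)"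
    using A by (simp add: symmetric_association_scheme_def)
  \<comment> \<open>The entries are 0 or 1, so the sum counts the relations containing the
    pair.\<close>
  then have "1 = (\<Sum>i\<le>d. A i $$ (x, y))"
    using xy by (simp add: mat_lincomb_def all_ones_mat_def)
  also have "\<dots> = (\<Sum>i\<le>d. of_bool (A i $$ (x, y) = 1))"
    using 01 by (intro sum.cong) fastforce+
  also have "\<dots> = of_nat (card {i \<in> {..d}. A i $$ (x, y) = 1})"
    by (subst sum_of_bool_eq) (auto intro: arg_cong[where f = card])
  finally have "card {i \<in> {..d}. A i $$ (x, y) = 1} = 1" by (metis of_nat_1_eq_iff)
  then obtain i where "{i \<in> {..d}. A i $$ (x, y) = 1} = {i}" by (auto simp: card_1_singleton_iff)
  then show "\<exists>!i. i \<le> d \<and> A i $$ (x, y) = 1" by (intro ex1I[of _ i]) blast+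
qed

lemma scheme_imp_weighing_scheme:
  assumes "2 \<le> m" "2 \<le> n" "k < m * n"
    and A: "symmetric_association_scheme N 6 A" and E: "primitive_idempotent_basis N 6 A E"
    and P: "first_eigenmatrix N 6 A E (map_mat complex_of_real (P_matrix (real m) (real n) (real k)))"
  shows "\<exists>c. weighing_scheme m n k N c"
proof
  define c where "c x y = (THE i. i \<le> 6 \<and> A i $$ (x, y) = 1)" for x y
  have c: "c x y \<le> 6" "A (c x y) $$ (x, y) = 1" if "x < N" "y < N" for x y
    using theI'[OF scheme_relation(1)[OF A that]] by (auto simp: c_def)
  have Ac: "A i $$ (x, y) = of_bool (c x y = i)" if "x < N" "y < N" "i \<le> 6" for x y i
  proof (cases "c x y = i")
    case False
    then have "A i $$ (x, y) \<noteq> 1" using scheme_relation(1)[OF A that(1,2)] c[OF that(1,2)] that(3) by blast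
    then show ?thesis using False scheme_relation(2)[OF A that] by simp
  qed (use c[OF that(1,2)] in simp)
  have car: "A i \<in> carrier_mat N N" "(A i)\<^sup>T = A i" if "i \<le> 6" for i
    using A that by (auto simp: symmetric_association_scheme_def)
  \<comment> \<open>The \<open>A j\<close> have disjoint supports, so an entry of the combination is
    \<open>f\<close> at the relation index.\<close>
  have comb_A: "mat_lincomb N 6 (\<lambda>j. complex_of_real (f j)) A = mat N N (\<lambda>(x, y). complex_of_real (f (c x y)))"
    for f :: "nat \<Rightarrow> real"
  proof (rule eq_matI)
    fix x y assume "x < dim_row (mat N N (\<lambda>(x, y). complex_of_real (f (c x y))))"
      "y < dim_col (mat N N (\<lambda>(x, y). complex_of_real (f (c x y))))"
    then have xy: "x < N" "y < N" by simp_all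
    have "(\<Sum>j\<le>6. complex_of_real (f j) * A j $$ (x, y)) = (\<Sum>j\<le>6. if j = c x y then complex_of_real (f j) else 0)"
      using Ac[OF xy] by (intro sum.cong) auto
    then show "mat_lincomb N 6 (\<lambda>j. complex_of_real (f j)) A $$ (x, y) =
        mat N N (\<lambda>(x, y). complex_of_real (f (c x y))) $$ (x, y)"
      using xy c[OF xy] by (simp add: mat_lincomb_def)
  qed (simp_all add: mat_lincomb_def)
  \<comment> \<open>The same matrix in the basis of idempotents: \<open>P\<close> carries the
    coefficients \<open>f\<close> to the vector of eigenvalues.\<close>
  have comb_E: "mat_lincomb N 6 (\<lambda>j. complex_of_real (f j)) A =
      mat_lincomb N 6 (\<lambda>i. complex_of_real (eigenvalue m n k f i)) E" for f :: "nat \<Rightarrow> real"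
  proof (rule eq_matI)
    let ?P = "P_matrix (real m) (real n) (real k)"
    fix x y assume "x < dim_row (mat_lincomb N 6 (\<lambda>i. complex_of_real (eigenvalue m n k f i)) E)"
      "y < dim_col (mat_lincomb N 6 (\<lambda>i. complex_of_real (eigenvalue m n k f i)) E)"
    then have xy: "x < N" "y < N" by (simp_all add: mat_lincomb_def)
    have dims: "dim_row ?P = 7" "dim_col ?P = 7"
      by (simp_all add: P_matrix_def Let_def mat_of_rows_list_def)
    have "A j $$ (x, y) = (\<Sum>i\<le>6. complex_of_real (?P $$ (i, j)) * E i $$ (x, y))" if "j \<le> 6" for j
    proof -
      have "A j = mat_lincomb N 6 (\<lambda>i. map_mat complex_of_real ?P $$ (i, j)) E"
        using P that by (simp add: first_eigenmatrix_def)
      also have "\<dots> $$ (x, y) = (\<Sum>i\<le>6. map_mat complex_of_real ?P $$ (i, j) * E i $$ (x, y))"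
        using xy by (simp add: mat_lincomb_def)
      also have "\<dots> = (\<Sum>i\<le>6. complex_of_real (?P $$ (i, j)) * E i $$ (x, y))"
        using that dims by (intro sum.cong) auto
      finally show ?thesis .
    qed
    then have "(\<Sum>j\<le>6. complex_of_real (f j) * A j $$ (x, y)) =
        (\<Sum>j\<le>6. \<Sum>i\<le>6. complex_of_real (f j * ?P $$ (i, j)) * E i $$ (x, y))"
      by (simp add: sum_distrib_left mult.assoc)
    also have "\<dots> = (\<Sum>i\<le>6. complex_of_real (eigenvalue m n k f i) * E i $$ (x, y))"
      by (subst sum.swap) (simp add: eigenvalue_def sum_distrib_right)
    finally show "mat_lincomb N 6 (\<lambda>j. complex_of_real (f j)) A $$ (x, y) =
        mat_lincomb N 6 (\<lambda>i. complex_of_real (eigenvalue m n k f i)) E $$ (x, y)"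
      using xy by (simp add: mat_lincomb_def)
  qed (simp_all add: mat_lincomb_def)
  show "weighing_scheme m n k N c"
  proof
    \<comment> \<open>An empty point set would make every matrix of order \<open>N\<close> equal to
      the zero matrix.\<close>
    have "A 0 \<noteq> 0\<^sub>m N N" using A by (auto simp: symmetric_association_scheme_def)
    then show "N > 0" using car[of 0] by (cases "N = 0") (auto intro!: eq_matI)
    fix x y assume xy: "x < N" "y < N"
    show "c x y \<le> 6" by (rule c(1)[OF xy])
    have "A 0 = 1\<^sub>m N" using A by (simp add: symmetric_association_scheme_def)
    then show "c x y = 0 \<longleftrightarrow> x = y" using Ac[OF xy, of 0] xy by (cases "x = y") auto
    have "A (c x y) $$ (y, x) = 1"
      using c[OF xy] car[OF c(1)[OF xy]] xy by (metis carrier_matD index_transpose_mat(1))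
    then show "c x y = c y x" using Ac[OF xy(2,1) c(1)[OF xy]] by (simp split: if_splits)
    fix f g h :: "nat \<Rightarrow> real"
    assume "eigenvalue m n k f i * eigenvalue m n k g i = eigenvalue m n k h i" if "i \<le> 6" for i
    then have "mat_lincomb N 6 (\<lambda>i. complex_of_real (eigenvalue m n k f i) * complex_of_real (eigenvalue m n k g i)) E =
        mat_lincomb N 6 (\<lambda>i. complex_of_real (eigenvalue m n k h i)) E"
      by (intro mat_lincomb_cong) (metis of_real_mult)
    then have "mat N N (\<lambda>(x, y). complex_of_real (f (c x y))) * mat N N (\<lambda>(x, y). complex_of_real (g (c x y))) =
        mat N N (\<lambda>(x, y). complex_of_real (h (c x y)))"
      unfolding comb_A[symmetric] comb_E idempotent_lincomb_mult[OF A E] .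
    from arg_cong[OF this, of "\<lambda>M. M $$ (x, y)"]
    have "complex_of_real (\<Sum>z<N. f (c x z) * g (c z y)) = complex_of_real (h (c x y))"
      using xy by (simp add: mat_mult_mat)
    then show "(\<Sum>z<N. f (c x z) * g (c z y)) = h (c x y)" by (simp only: of_real_eq_iff)
  qed (use assms in auto)
qed

theorem theorem4p4:
  fixes m n k :: nat
  assumes "2 \<le> m" and "2 \<le> n" and "1 \<le> k" and "k < m * n"
    and "\<exists>N A E. symmetric_association_scheme N 6 A \<and>
           primitive_idempotent_basis N 6 A E \<and>
           first_eigenmatrix N 6 A E (map_mat complex_of_real (P_matrix (real m) (real n) (real k))) \<and>
           second_eigenmatrix N 6 A E (map_mat complex_of_real (Q_matrix (real m) (real n) (real k)))"
  shows "\<exists>W :: real mat.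
           quasi_balanced_weighing_matrix (m * n) k W \<and>
           (\<exists>lam1 lam2. symmetric_gdd (m * n) k m n lam1 lam2 (abs_mat W)) \<and>
           abs_mat W * group_mat m n = group_mat m n * abs_mat W \<and>
           group_mat m n * abs_mat W = (real k / real m) \<cdot>\<^sub>m all_ones_mat (m * n)"
proof -
  obtain N c where "weighing_scheme m n k N c"
    using assms scheme_imp_weighing_scheme by blast
  then show ?thesis by (rule weighing_scheme.ex_weighing_matrix)
qed

end
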